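(* Let $u^{(0)}\in W^{1,1}(G)$ with $u^{(0)}=f$ on $\partial K$ (trace sense), and let $u^{(j+1)}:=T(u^{(j)})$ for $j\in\mathbb{N}_0$. There exists a constant $\rho>0$ (compare the explicit expression $$\rho=\max\{\rho_1,\rho_2\},\qquad \rho_1:=2\left(\frac{c_2}{c_1}\right)^{1/2}\|\nabla f\|_{L^2(G)}\left[1+\frac{|G|}{2\pi\sigma^4}c_P\left(\|f\|_{L^1(G)}+\|\nabla f\|_{L^1(G)}\right)\right],\qquad \rho_2:=2\left(\frac{c_2}{c_1}\right)^{1/2}\|\nabla f\|_{L^2(G)}\frac{|G|}{2\pi}c_P\ )$$ such that in case $\sigma^4>\rho$ $$\sup_{j\in\mathbb{N}_0}\|u^{(j)}\|_{W^{1,1}(G)}<\infty.$$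
   Context: Setting. $\Omega\subset\mathbb{R}^2$ is a bounded Lipschitz domain. $C_1,\dots,C_N\subset\Omega$ ($N\ge 1$) are finitely many disjoint open Lipschitz domains, $C_i\neq\Omega$, with $\mathrm{dist}(C_i,C_j)>0$ for $i\ne j$. Put $C:=\bigcup_{i=1}^N C_i$, $K:=\overline{C}$, $G:=\Omega\setminus K$, and assume $K$ is a compact subset of $\Omega$ (so $\partial K\subset\partial G$). The function $f: C\to[0,1]$ is of class $W^{1,2}(C)$; a fixed extension of it to a function in $W^{1,2}(\Omega)$ is also denoted $f$. The map $D:\mathbb{R}^2\to\mathbb{R}^{2\times2}$ is continuous, $D(p)$ is symmetric for every $p\in\mathbb{R}^2$, and there are constants $c_1,c_2>0$ with (normalization $\lambda=1$) $$c_1\left(1+|p|^2\right)^{-1/2}|q|^2\le D(p)q\cdot q\le c_2|q|^2\quad\text{for all }p,q\in\mathbb{R}^2.$$ $\sigma>0$ is the smoothing parameter. For $w\in L^1(G)$ set $w_\sigma(x):=\int_G k_\sigma(x-z)w(z)\,dz$, $x\in\mathbb{R}^2$, where $k_\sigma(z)=\frac{1}{2\pi\sigma^2}\exp\left(-\frac{|z|^2}{2\sigma^2}\right)$. Operator $T$ (its dependence on $\sigma$ is not indicated in the notation). Let $\mathcal{C}:=\{v\in W^{1,2}(G): v=f \text{ on }\partial K\text{ in the trace sense}\}$. For $w\in W^{1,1}(G)$ and $v\in W^{1,2}(G)$ let $J_w(v):=\int_G D(\nabla w_\sigma)\nabla v\cdot\nabla v\,dx$. For $w\in W^{1,1}(G)$,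 $T(w)$ is defined as the unique minimiser of $J_w$ in $\mathcal{C}$; this defines $T:W^{1,1}(G)\to W^{1,1}(G)$. Constant $c_P$. $c_P>0$ is a (Poincaré) constant such that $\|w\|_{L^1(G)}\le c_P\left(\|\nabla(w-f)\|_{L^1(G)}+\|f\|_{L^1(G)}\right)$ for all $w\in W^{1,1}(G)$ with $w=f$ on $\partial K$ in the trace sense. *)

theory Defs
  imports "HOL-Analysis.Analysis"
begin

type_synonym plane = "real^2"

section \<open>Lipschitz domains\<close>

text \<open>After a rigid change of coordinates the set is, near each of its boundary points,
  the strict epigraph of a Lipschitz function of one variable.\<close>

definition lipschitz_domain :: "plane set \<Rightarrow> bool" where
  "lipschitz_domain U \<longleftrightarrow> open U \<and> connected U \<and> U \<noteq> {} \<and>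
    (\<forall>x\<in>frontier U. \<exists>r>0. \<exists>Q :: plane \<Rightarrow> plane. \<exists>\<gamma> :: real \<Rightarrow> real. \<exists>L.
       orthogonal_transformation Q \<and> L-lipschitz_on UNIV \<gamma> \<and>
       U \<inter> ball x r = {y \<in> ball x r. \<gamma> (Q y $ 1) < Q y $ 2})"

section \<open>Sobolev functions\<close>

text \<open>The classical gradient; meaningful only where the function is differentiable.\<close>

definition gradient :: "(plane \<Rightarrow> real) \<Rightarrow> plane \<Rightarrow> plane" where
  "gradient \<phi> x = (THE g. GDERIV \<phi> x :> g)"

primrec C_k :: "nat \<Rightarrow> (plane \<Rightarrow> real) \<Rightarrow> bool" where
  "C_k 0 \<phi> \<longleftrightarrow> continuous_on UNIV \<phi>"
| "C_k (Suc k) \<phi> \<longleftrightarrow> (\<forall>x. \<phi> differentiable (at x)) \<and> (\<forall>i. C_k k (\<lambda>x. gradient \<phi> x $ i))"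

definition test_functions :: "plane set \<Rightarrow> (plane \<Rightarrow> real) set" where
  "test_functions U =
    {\<phi>. (\<forall>k. C_k k \<phi>) \<and> (\<exists>S. compact S \<and> S \<subseteq> U \<and> (\<forall>x. x \<notin> S \<longrightarrow> \<phi> x = 0))}"

definition Lp :: "real \<Rightarrow> plane set \<Rightarrow> (plane \<Rightarrow> 'a::euclidean_space) \<Rightarrow> bool" where
  "Lp p U u \<longleftrightarrow> u \<in> borel_measurable (lebesgue_on U) \<and>
     integrable (lebesgue_on U) (\<lambda>x. norm (u x) powr p)"

definition Lp_norm :: "real \<Rightarrow> plane set \<Rightarrow> (plane \<Rightarrow> 'a::euclidean_space) \<Rightarrow> real" where
  "Lp_norm p U u = (LINT x|lebesgue_on U. norm (u x) powr p) powr (1 / p)"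

definition locally_integrable :: "plane set \<Rightarrow> (plane \<Rightarrow> 'a::euclidean_space) \<Rightarrow> bool" where
  "locally_integrable U u \<longleftrightarrow>
    (\<forall>S. compact S \<and> S \<subseteq> U \<longrightarrow> integrable (lebesgue_on S) u)"

definition has_weak_gradient ::
    "plane set \<Rightarrow> (plane \<Rightarrow> real) \<Rightarrow> (plane \<Rightarrow> plane) \<Rightarrow> bool" where
  "has_weak_gradient U u g \<longleftrightarrow> locally_integrable U u \<and> locally_integrable U g \<and>
    (\<forall>\<phi>\<in>test_functions U.
       (LINT x|lebesgue_on U. u x *\<^sub>R gradient \<phi> x) = - (LINT x|lebesgue_on U. \<phi> x *\<^sub>R g x))"

text \<open>Functions are represented pointwise; a weak gradient is unique up to a null set, and
  \<open>weak_gradient\<close> picks one representative.\<close>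

definition weak_gradient :: "plane set \<Rightarrow> (plane \<Rightarrow> real) \<Rightarrow> plane \<Rightarrow> plane" where
  "weak_gradient U u = (SOME g. has_weak_gradient U u g)"

definition W1 :: "real \<Rightarrow> plane set \<Rightarrow> (plane \<Rightarrow> real) set" where
  "W1 p U = {u. Lp p U u \<and> (\<exists>g. has_weak_gradient U u g \<and> Lp p U g)}"

definition W11_norm :: "plane set \<Rightarrow> (plane \<Rightarrow> real) \<Rightarrow> real" where
  "W11_norm U u = Lp_norm 1 U u + Lp_norm 1 U (weak_gradient U u)"

section \<open>Traces\<close>

text \<open>One-dimensional Hausdorff measure (arc length). The explicit boundedness is needed because
  \<open>diameter\<close> is unspecified on unbounded sets. Since \<open>hausdorff1_outer\<close> is a metric outer
  measure, it is countably additive on the Borel sets, so \<open>measure_of\<close> does not collapse to the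
  zero measure.\<close>

definition hausdorff1_outer :: "plane set \<Rightarrow> ennreal" where
  "hausdorff1_outer S = (SUP \<delta>\<in>{0<..}. 
     INF A\<in>{A :: nat \<Rightarrow> plane set. S \<subseteq> (\<Union>i. A i) \<and> (\<forall>i. bounded (A i) \<and> diameter (A i) \<le> \<delta>)}.
       \<Sum>i. ennreal (diameter (A i)))"

definition hausdorff1 :: "plane measure" where
  "hausdorff1 = measure_of UNIV (sets borel) hausdorff1_outer"

text \<open>The trace on a closed part \<open>\<Gamma>\<close> of the boundary of \<open>G\<close>, i.e. the continuous extension to
  \<open>W\<^sup>1\<^sup>,\<^sup>1(G)\<close>, with values in \<open>L\<^sup>1(\<Gamma>)\<close>, of the restriction \<open>\<phi> \<mapsto> \<phi>|\<Gamma>\<close> of those \<open>W\<^sup>1\<^sup>,\<^sup>1\<close> functions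
  that are continuous up to the boundary. On bounded sets \<open>W\<^sup>1\<^sup>,\<^sup>2(G) \<subseteq> W\<^sup>1\<^sup>,\<^sup>1(G)\<close>, and the
  \<open>W\<^sup>1\<^sup>,\<^sup>2\<close> trace is the restriction of this one.\<close>

definition has_trace ::
    "plane set \<Rightarrow> plane set \<Rightarrow> (plane \<Rightarrow> real) \<Rightarrow> (plane \<Rightarrow> real) \<Rightarrow> bool" where
  "has_trace G \<Gamma> u t \<longleftrightarrow> u \<in> W1 1 G \<and> t \<in> borel_measurable borel \<and>
    (\<exists>\<phi> :: nat \<Rightarrow> plane \<Rightarrow> real.
       (\<forall>n. \<phi> n \<in> W1 1 G \<and> continuous_on (closure G) (\<phi> n)) \<and>
       (\<lambda>n. W11_norm G (\<lambda>x. \<phi> n x - u x)) \<longlonglongrightarrow> 0 \<and>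
       (\<lambda>n. \<integral>\<^sup>+x\<in>\<Gamma>. ennreal \<bar>\<phi> n x - t x\<bar> \<partial>hausdorff1) \<longlonglongrightarrow> 0)"

definition trace_eq :: "plane set \<Rightarrow> plane set \<Rightarrow> (plane \<Rightarrow> real) \<Rightarrow> (plane \<Rightarrow> real) \<Rightarrow> bool" where
  "trace_eq G \<Gamma> v f \<longleftrightarrow> has_trace G \<Gamma> (\<lambda>x. v x - f x) (\<lambda>x. 0)"

section \<open>The diffusion operator\<close>

definition gauss_kernel :: "real \<Rightarrow> plane \<Rightarrow> real" where
  "gauss_kernel \<sigma> z = 1 / (2 * pi * \<sigma>\<^sup>2) * exp (- (norm z)\<^sup>2 / (2 * \<sigma>\<^sup>2))"

definition smoothing :: "real \<Rightarrow> plane set \<Rightarrow> (plane \<Rightarrow> real) \<Rightarrow> plane \<Rightarrow> real" where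
  "smoothing \<sigma> G w x = (LINT z|lebesgue_on G. gauss_kernel \<sigma> (x - z) * w z)"

definition admissible :: "plane set \<Rightarrow> plane set \<Rightarrow> (plane \<Rightarrow> real) \<Rightarrow> (plane \<Rightarrow> real) set" where
  "admissible G K f = {v \<in> W1 2 G. trace_eq G (frontier K) v f}"

definition J_functional ::
    "real \<Rightarrow> plane set \<Rightarrow> (plane \<Rightarrow> real^2^2) \<Rightarrow> (plane \<Rightarrow> real) \<Rightarrow> (plane \<Rightarrow> real) \<Rightarrow> real" where
  "J_functional \<sigma> G D w v =
    (LINT x|lebesgue_on G.
       (D (gradient (smoothing \<sigma> G w) x) *v weak_gradient G v x) \<bullet> weak_gradient G v x)"

text \<open>The operator \<open>T\<close>, as the graph of a map between classes of functions modulo null sets: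
  \<open>is_T \<dots> w v\<close> says that \<open>v\<close> represents the minimiser \<open>T(w)\<close>. The minimiser is unique as such a
  class, so \<open>v\<close> is determined by \<open>w\<close> up to a null set.\<close>

definition is_T :: "real \<Rightarrow> plane set \<Rightarrow> plane set \<Rightarrow> (plane \<Rightarrow> real) \<Rightarrow> (plane \<Rightarrow> real^2^2) \<Rightarrow>
    (plane \<Rightarrow> real) \<Rightarrow> (plane \<Rightarrow> real) \<Rightarrow> bool" where
  "is_T \<sigma> G K f D w v \<longleftrightarrow> w \<in> W1 1 G \<and> v \<in> admissible G K f \<and>
    (\<forall>v'\<in>admissible G K f. J_functional \<sigma> G D w v \<le> J_functional \<sigma> G D w v')"

definition T_iteration :: "real \<Rightarrow> plane set \<Rightarrow> plane set \<Rightarrow> (plane \<Rightarrow> real) \<Rightarrow>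
    (plane \<Rightarrow> real^2^2) \<Rightarrow> (nat \<Rightarrow> plane \<Rightarrow> real) \<Rightarrow> bool" where
  "T_iteration \<sigma> G K f D u \<longleftrightarrow> u 0 \<in> W1 1 G \<and> trace_eq G (frontier K) (u 0) f \<and>
    (\<forall>j. is_T \<sigma> G K f D (u j) (u (Suc j)))"

section \<open>The explicit threshold\<close>

definition rho1 :: "real \<Rightarrow> plane set \<Rightarrow> (plane \<Rightarrow> real) \<Rightarrow> real \<Rightarrow> real \<Rightarrow> real \<Rightarrow> real" where
  "rho1 \<sigma> G f c1 c2 cP = 2 * sqrt (c2 / c1) * Lp_norm 2 G (weak_gradient G f) *
     (1 + measure lebesgue G / (2 * pi * \<sigma>^4) * cP *
            (Lp_norm 1 G f + Lp_norm 1 G (weak_gradient G f)))"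

definition rho2 :: "plane set \<Rightarrow> (plane \<Rightarrow> real) \<Rightarrow> real \<Rightarrow> real \<Rightarrow> real \<Rightarrow> real" where
  "rho2 G f c1 c2 cP = 2 * sqrt (c2 / c1) * Lp_norm 2 G (weak_gradient G f) *
     (measure lebesgue G / (2 * pi)) * cP"

end

theory Submission
  imports Defs
begin

text \<open>
  The iterates stay bounded because one step of \<open>T\<close> gains a square root. Write \<open>\<nabla>\<close> for the weak
  gradient and \<open>a\<^sub>j = \<parallel>\<nabla>u\<^sub>j\<parallel>\<^sub>1\<close>. Differentiating the Gaussian under the integral sign gives
  \<open>\<bar>\<nabla>(u\<^sub>j)\<^sub>\<sigma>\<bar> \<le> P\<close> everywhere with \<open>P = \<parallel>u\<^sub>j\<parallel>\<^sub>1 / (2 \<pi> \<sigma>\<^sup>3)\<close> (\<open>norm_gradient_smoothing_le\<close>). On arguments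
  of size at most \<open>P\<close> the lower ellipticity bound of \<open>D\<close> is at least \<open>c1 / (1 + P)\<close>. The function \<open>f\<close>
  is admissible, so the minimiser \<open>u\<^sub>j\<^sub>+\<^sub>1\<close> has no more energy than \<open>f\<close>, and therefore
  \<open>c1 / (1 + P) \<parallel>\<nabla>u\<^sub>j\<^sub>+\<^sub>1\<parallel>\<^sub>2\<^sup>2 \<le> c2 \<parallel>\<nabla>f\<parallel>\<^sub>2\<^sup>2\<close>. The Cauchy-Schwarz inequality on the bounded set \<open>G\<close> yields
  \<open>a\<^sub>j\<^sub>+\<^sub>1\<^sup>2 \<le> \<bar>G\<bar> (c2 / c1) \<parallel>\<nabla>f\<parallel>\<^sub>2\<^sup>2 (1 + P)\<close> (\<open>is_T_gradient_bound\<close>), and the Poincare inequality bounds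
  \<open>P\<close> linearly in \<open>a\<^sub>j\<close>. Altogether \<open>a\<^sub>j\<^sub>+\<^sub>1\<^sup>2 \<le> A + B a\<^sub>j\<close> with constants depending on \<open>\<sigma>\<close>, and such a
  sublinear recursion has only bounded orbits (\<open>bounded_of_sublinear_recursion\<close>). A further use of
  the Poincare inequality bounds the full norms.

  The analytic substance lies in the foundations. The weak gradient is a chosen representative, so
  its integrability, its additivity and the vanishing of the gradient of \<open>0\<close> all rest on uniqueness
  almost everywhere (\<open>has_weak_gradient_AE_unique\<close>). This is the fundamental lemma of the calculus
  of variations (\<open>locally_integrable_AE_eq_0\<close>), which in turn requires a supply of smooth, compactly
  supported functions (\<open>box_bump\<close>).
\<close>

section \<open>Smooth bump functions\<close>

lemma gradient_eq: "GDERIV \<phi> x :> g \<Longrightarrow> gradient \<phi> x = g"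
  unfolding gradient_def gderiv_def
  by (rule the_equality) (auto dest: has_derivative_unique simp: fun_eq_iff vector_eq_ldot)

text \<open>The functions \<open>exp (- 1 / t) / t ^ m\<close>, extended by \<open>0\<close> to \<open>t \<le> 0\<close>. The parameter \<open>m\<close> makes
  the family closed under differentiation up to linear combinations, so that smoothness of the
  classical flat function (\<open>m = 0\<close>) needs no bookkeeping of its higher derivatives.\<close>

definition exp_recip :: "nat \<Rightarrow> real \<Rightarrow> real" where
  "exp_recip m t = (if t > 0 then exp (- 1 / t) / t ^ m else 0)"

lemma exp_recip_tendsto_0: "(exp_recip m \<longlongrightarrow> 0) (at_right 0)"
proof -
  have "((\<lambda>t::real. inverse t ^ m / exp (inverse t)) \<longlongrightarrow> 0) (at_right 0)"
    using filterlim_compose[OF tendsto_power_div_exp_0 filterlim_inverse_at_top_right] .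
  moreover have "\<forall>\<^sub>F t in at_right 0. inverse t ^ m / exp (inverse t) = exp_recip m t"
    by (rule eventually_mono[OF eventually_at_right_less])
       (simp add: exp_recip_def exp_minus field_simps)
  ultimately show ?thesis by (rule Lim_transform_eventually)
qed

lemma DERIV_exp_recip: "DERIV (exp_recip m) t :> exp_recip (Suc (Suc m)) t - real m * exp_recip (Suc m) t"
proof (cases t "0::real" rule: linorder_cases)
  case greater
  have "DERIV (\<lambda>t. exp (- 1 / t) / t ^ m) t :> exp_recip (Suc (Suc m)) t - real m * exp_recip (Suc m) t"
    using greater
    by (auto intro!: derivative_eq_intros simp: exp_recip_def field_simps power2_eq_square
        simp flip: power_Suc)
       (cases m; simp add: field_simps)
  moreover have "\<forall>\<^sub>F s in nhds t. exp (- 1 / s) / s ^ m = exp_recip m s"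
    using eventually_nhds_in_open[of "{0<..}" t] greater
    by (auto elim!: eventually_mono simp: exp_recip_def)
  ultimately show ?thesis
    by (subst DERIV_cong_ev[OF refl _ refl, symmetric]) auto
next
  case less
  have "\<forall>\<^sub>F s in nhds t. exp_recip m s = 0"
    using eventually_nhds_in_open[of "{..<0}" t] less
    by (auto elim!: eventually_mono simp: exp_recip_def)
  then have "DERIV (exp_recip m) t :> 0"
    by (subst DERIV_cong_ev[OF refl _ refl]) auto
  then show ?thesis using less by (simp add: exp_recip_def)
next
  case equal
  have "((\<lambda>h. exp_recip m h / h) \<longlongrightarrow> 0) (at 0)"
  proof (rule filterlim_split_at)
    show "((\<lambda>h. exp_recip m h / h) \<longlongrightarrow> 0) (at_left 0)"
      by (rule Lim_transform_eventually[OF tendsto_const])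
         (auto simp: eventually_at_filter exp_recip_def)
    show "((\<lambda>h. exp_recip m h / h) \<longlongrightarrow> 0) (at_right 0)"
      by (rule Lim_transform_eventually[OF exp_recip_tendsto_0[of "Suc m"]],
          rule eventually_mono[OF eventually_at_right_less]) (auto simp: exp_recip_def)
  qed
  then show ?thesis by (simp add: equal DERIV_def exp_recip_def)
qed

text \<open>A class of functions built from closure rules instead of from derivatives of all orders: it
  suffices that each rule produces gradients whose components are again in the class. Such a class
  consists of \<open>C\<^sup>\<infinity>\<close> functions, and it is large enough for the bumps needed below.\<close>

inductive smooth :: "(plane \<Rightarrow> real) \<Rightarrow> bool" where
  const: "smooth (\<lambda>x. c)"
| coord: "smooth (\<lambda>x. x $ i)"
| add: "smooth \<phi> \<Longrightarrow> smooth \<psi> \<Longrightarrow> smooth (\<lambda>x. \<phi> x + \<psi> x)"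
| mult: "smooth \<phi> \<Longrightarrow> smooth \<psi> \<Longrightarrow> smooth (\<lambda>x. \<phi> x * \<psi> x)"
| exp: "smooth \<phi> \<Longrightarrow> smooth (\<lambda>x. exp (\<phi> x))"
| exp_recip: "smooth \<phi> \<Longrightarrow> smooth (\<lambda>x. exp_recip m (\<phi> x))"

lemma smooth_GDERIV:
  "smooth \<phi> \<Longrightarrow> \<exists>g. (\<forall>x. GDERIV \<phi> x :> g x) \<and> (\<forall>i. smooth (\<lambda>x. g x $ i))"
proof (induction rule: smooth.induct)
  case (const c)
  show ?case by (intro exI[of _ "\<lambda>x. 0"]) (auto simp: GDERIV_const intro: smooth.const)
next
  case (coord i)
  show ?case
    by (intro exI[of _ "\<lambda>x. axis i 1"])
       (auto simp: gderiv_def inner_axis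
          intro: smooth.const bounded_linear_imp_has_derivative bounded_linear_vec_nth)
next
  case (add \<phi> \<psi>)
  then obtain g h where "\<forall>x. GDERIV \<phi> x :> g x" "\<forall>i. smooth (\<lambda>x. g x $ i)"
    "\<forall>x. GDERIV \<psi> x :> h x" "\<forall>i. smooth (\<lambda>x. h x $ i)" by blast
  then show ?case by (intro exI[of _ "\<lambda>x. g x + h x"]) (auto intro!: GDERIV_add smooth.add)
next
  case (mult \<phi> \<psi>)
  then obtain g h where "\<forall>x. GDERIV \<phi> x :> g x" "\<forall>i. smooth (\<lambda>x. g x $ i)"
    "\<forall>x. GDERIV \<psi> x :> h x" "\<forall>i. smooth (\<lambda>x. h x $ i)" by blast
  with mult.hyps show ?case
    by (intro exI[of _ "\<lambda>x. \<phi> x *\<^sub>R h x + \<psi> x *\<^sub>R g x"])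
       (auto intro!: GDERIV_mult smooth.add smooth.mult)
next
  case (exp \<phi>)
  then obtain g where "\<forall>x. GDERIV \<phi> x :> g x" "\<forall>i. smooth (\<lambda>x. g x $ i)" by blast
  with exp.hyps show ?case
    by (intro exI[of _ "\<lambda>x. exp (\<phi> x) *\<^sub>R g x"])
       (auto intro!: GDERIV_DERIV_compose[of _ _ _ exp] smooth.intros)
next
  case (exp_recip \<phi> m)
  then obtain g where g: "\<forall>x. GDERIV \<phi> x :> g x" "\<forall>i. smooth (\<lambda>x. g x $ i)" by blast
  have "smooth (\<lambda>x. exp_recip (Suc (Suc m)) (\<phi> x) + (- real m) * exp_recip (Suc m) (\<phi> x))"
    using exp_recip.hyps by (intro smooth.intros)
  then have "smooth (\<lambda>x. exp_recip (Suc (Suc m)) (\<phi> x) - real m * exp_recip (Suc m) (\<phi> x))"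
    by simp
  with g show ?case
    by (intro exI[of _ "\<lambda>x. (exp_recip (Suc (Suc m)) (\<phi> x) - real m * exp_recip (Suc m) (\<phi> x)) *\<^sub>R g x"])
       (auto intro!: GDERIV_DERIV_compose[OF _ DERIV_exp_recip] smooth.mult)
qed

lemma smooth_C_k: "smooth \<phi> \<Longrightarrow> C_k k \<phi>"
proof (induction k arbitrary: \<phi>)
  case 0
  then obtain g where "\<forall>x. GDERIV \<phi> x :> g x" using smooth_GDERIV by blast
  then show ?case
    by (auto simp: gderiv_def continuous_on_eq_continuous_at intro: has_derivative_continuous)
next
  case (Suc k)
  obtain g where g: "\<forall>x. GDERIV \<phi> x :> g x" "\<forall>i. smooth (\<lambda>x. g x $ i)"
    using smooth_GDERIV[OF Suc.prems] by blast
  moreover have "gradient \<phi> = g" using g gradient_eq by blast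
  ultimately show ?case
    using Suc.IH by (auto simp: gderiv_def differentiable_def)
qed

text \<open>The product of flat functions is positive exactly on \<open>box a b\<close>. Writing it as \<open>p\<close>, the
  functions \<open>1 - exp (- n p)\<close> are still smooth, take values in \<open>[0,1]\<close>, and increase to the
  indicator of the box, so they can replace it inside integrals by dominated convergence.\<close>

definition box_bump :: "plane \<Rightarrow> plane \<Rightarrow> nat \<Rightarrow> plane \<Rightarrow> real" where
  "box_bump a b n x = 1 - exp (- real n *
     (\<Prod>i\<in>UNIV. exp_recip 0 (x $ i - a $ i) * exp_recip 0 (b $ i - x $ i)))"

lemma box_bump_smooth: "smooth (box_bump a b n)"
proof -
  have "smooth (\<lambda>x. 1 + (- 1) * exp (- real n *
     ((exp_recip 0 (x $ 1 + (- a $ 1)) * exp_recip 0 (b $ 1 + (- 1) * x $ 1)) *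
      (exp_recip 0 (x $ 2 + (- a $ 2)) * exp_recip 0 (b $ 2 + (- 1) * x $ 2)))))"
    by (intro smooth.intros)
  then show ?thesis by (simp add: box_bump_def[abs_def] UNIV_2)
qed

lemma exp_recip_nonneg: "exp_recip m t \<ge> 0"
  by (simp add: exp_recip_def)

lemma box_bump_range: "0 \<le> box_bump a b n x" "box_bump a b n x \<le> 1"
  by (auto simp: box_bump_def intro!: mult_nonneg_nonneg prod_nonneg exp_recip_nonneg)

lemma box_bump_outside: "x \<notin> box a b \<Longrightarrow> box_bump a b n x = 0"
  by (force simp: box_bump_def mem_box_cart exp_recip_def)

lemma box_bump_tendsto: "(\<lambda>n. box_bump a b n x) \<longlonglongrightarrow> indicator (box a b) x"
proof (cases "x \<in> box a b")
  case True
  define p where "p = (\<Prod>i\<in>UNIV. exp_recip 0 (x $ i - a $ i) * exp_recip 0 (b $ i - x $ i))"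
  have "p > 0"
    using True by (auto simp: p_def mem_box_cart exp_recip_def intro!: prod_pos)
  then have "norm (exp (- p)) < (1::real)" by simp
  then have "(\<lambda>n. exp (- p) ^ n) \<longlonglongrightarrow> (0::real)" by (rule LIMSEQ_power_zero)
  then have "(\<lambda>n. 1 - exp (- p) ^ n) \<longlonglongrightarrow> 1 - 0"
    by (rule tendsto_diff[OF tendsto_const])
  moreover have "box_bump a b n x = 1 - exp (- p) ^ n" for n
    by (simp add: box_bump_def p_def flip: exp_of_nat_mult)
  ultimately show ?thesis using True by simp
next
  case False
  then show ?thesis by (simp add: box_bump_outside)
qed

lemma box_bump_test_function: "cbox a b \<subseteq> U \<Longrightarrow> box_bump a b n \<in> test_functions U"
  unfolding test_functions_def
  using smooth_C_k[OF box_bump_smooth] box_bump_outside box_subset_cbox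
  by (fastforce intro: exI[of _ "cbox a b"])

section \<open>Weak gradients\<close>

text \<open>For compact \<open>S\<close> this turns local integrability into integrability over all of \<open>U\<close> of the
  products with test functions.\<close>

lemma
  fixes F :: "plane \<Rightarrow> 'a::{banach, second_countable_topology}"
  assumes "S \<subseteq> U" "S \<in> sets lebesgue" "U \<in> sets lebesgue" "\<And>x. x \<in> U - S \<Longrightarrow> F x = 0"
  shows integrable_lebesgue_on_supp: "integrable (lebesgue_on U) F \<longleftrightarrow> integrable (lebesgue_on S) F"
    and integral_lebesgue_on_supp: "(LINT x|lebesgue_on U. F x) = (LINT x|lebesgue_on S. F x)"
proof -
  have "(\<lambda>x. indicator U x *\<^sub>R F x) = (\<lambda>x. indicator S x *\<^sub>R F x)"
    using assms by (fastforce simp: indicator_def)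
  then show "integrable (lebesgue_on U) F \<longleftrightarrow> integrable (lebesgue_on S) F"
    "(LINT x|lebesgue_on U. F x) = (LINT x|lebesgue_on S. F x)"
    using assms by (simp_all add: integrable_restrict_space integral_restrict_space)
qed

lemma test_function_continuous:
  assumes "\<phi> \<in> test_functions U"
  shows "continuous_on UNIV \<phi>" "continuous_on UNIV (gradient \<phi>)"
proof -
  have C: "C_k k \<phi>" for k using assms by (auto simp: test_functions_def)
  show "continuous_on UNIV \<phi>" using C[of 0] by simp
  show "continuous_on UNIV (gradient \<phi>)"
    using C[of "Suc 0"] by (subst continuous_on_componentwise) (auto simp: Basis_vec_def inner_axis)
qed

lemma test_function_support:
  assumes "\<phi> \<in> test_functions U"
  shows "\<exists>S. compact S \<and> S \<subseteq> U \<and> (\<forall>x. x \<notin> S \<longrightarrow> \<phi> x = 0) \<and> (\<forall>x. x \<notin> S \<longrightarrow> gradient \<phi> x = 0)"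
proof -
  obtain S where S: "compact S" "S \<subseteq> U" "\<forall>x. x \<notin> S \<longrightarrow> \<phi> x = 0"
    using assms by (auto simp: test_functions_def)
  have "gradient \<phi> x = 0" if "x \<notin> S" for x
  proof (rule gradient_eq)
    have "((\<lambda>x. 0) has_derivative (\<lambda>h. 0)) (at x)" by simp
    then show "GDERIV \<phi> x :> 0"
      unfolding gderiv_def inner_zero_right
    proof (rule has_derivative_transform_within_open)
      show "open (- S)" using S compact_imp_closed by blast
    qed (use S that in auto)
  qed
  with S show ?thesis by blast
qed

text \<open>Both sides of the integration by parts formula that defines weak gradients are integrals of
  this kind: scalar test function times vector field, or scalar function times gradient of a test
  function. Without integrability they would not be additive.\<close>

lemma locally_integrable_bilinear_compact_support:
  fixes h :: "plane \<Rightarrow> 'b::euclidean_space" and \<psi> :: "plane \<Rightarrow> 'a::euclidean_space"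
    and prod :: "'a \<Rightarrow> 'b \<Rightarrow> 'c::euclidean_space"
  assumes "bounded_bilinear prod" "locally_integrable U h" "U \<in> sets lebesgue"
    and S: "compact S" "S \<subseteq> U" "\<And>x. x \<notin> S \<Longrightarrow> \<psi> x = 0" and \<psi>: "continuous_on UNIV \<psi>"
  shows "integrable (lebesgue_on U) (\<lambda>x. prod (\<psi> x) (h x))"
proof -
  interpret bounded_bilinear prod by fact
  have [measurable]: "S \<in> sets lebesgue" using S(1) by (simp add: lmeasurable_compact fmeasurableD)
  have h: "integrable (lebesgue_on S) h"
    using assms by (auto simp: locally_integrable_def)
  then have [measurable]: "h \<in> borel_measurable (lebesgue_on S)" by auto
  have [measurable]: "\<psi> \<in> borel_measurable (lebesgue_on S)"
    using \<psi> by (intro continuous_imp_measurable_on_sets_lebesgue) (auto intro: continuous_on_subset)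
  have "bounded (\<psi> ` S)"
    using S(1) \<psi> by (meson compact_continuous_image compact_imp_bounded continuous_on_subset subset_UNIV)
  then obtain B where B: "\<And>x. x \<in> S \<Longrightarrow> norm (\<psi> x) \<le> B" by (auto simp: bounded_iff)
  obtain k where k: "k \<ge> 0" "\<And>a b. norm (prod a b) \<le> norm a * norm b * k"
    using nonneg_bounded by blast
  have "integrable (lebesgue_on S) (\<lambda>x. prod (\<psi> x) (h x))"
  proof (rule Bochner_Integration.integrable_bound)
    show "integrable (lebesgue_on S) (\<lambda>x. B * k * norm (h x))" using h by simp
    show "(\<lambda>x. prod (\<psi> x) (h x)) \<in> borel_measurable (lebesgue_on S)"
      by (rule borel_measurable_continuous_Pair) (auto intro!: continuous_intros continuous_on)
    have "norm (prod (\<psi> x) (h x)) \<le> norm (B * k * norm (h x))" if "x \<in> S" for x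
    proof -
      have "norm (prod (\<psi> x) (h x)) \<le> norm (\<psi> x) * norm (h x) * k" by (rule k)
      also have "\<dots> \<le> B * norm (h x) * k"
        using B[OF that] k by (intro mult_right_mono) auto
      finally show ?thesis by (simp add: ac_simps)
    qed
    then show "AE x in lebesgue_on S. norm (prod (\<psi> x) (h x)) \<le> norm (B * k * norm (h x))"
      by (intro AE_I2) (simp only: space_lebesgue_on)
  qed
  then show ?thesis
    using S assms by (subst integrable_lebesgue_on_supp[of S]) (auto simp: zero_left)
qed

text \<open>The bumps converge to the indicator of the open box and are bounded by \<open>1\<close>, so the hypothesis
  passes to the limit; the boundary of the box is a null set.\<close>

lemma integral_cbox_eq_0:
  fixes h :: "plane \<Rightarrow> 'a::euclidean_space"
  assumes "open U" "locally_integrable U h" "cbox a b \<subseteq> U"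
    and test: "\<And>\<phi>. \<phi> \<in> test_functions U \<Longrightarrow> (LINT x|lebesgue_on U. \<phi> x *\<^sub>R h x) = 0"
  shows "(LINT x|lebesgue_on (cbox a b). h x) = 0"
proof -
  let ?M = "lebesgue_on (cbox a b)"
  have h: "integrable ?M h" using assms by (auto simp: locally_integrable_def)
  then have [measurable]: "h \<in> borel_measurable ?M" by auto
  have bump_meas [measurable]: "box_bump a b n \<in> borel_measurable ?M" for n
    using smooth_C_k[OF box_bump_smooth, of 0]
    by (intro continuous_imp_measurable_on_sets_lebesgue) (auto intro: continuous_on_subset)
  have ind_meas [measurable]: "(\<lambda>x. indicator (box a b) x :: real) \<in> borel_measurable ?M"
    by (intro measurable_restrict_space1 borel_measurable_indicator fmeasurableD lmeasurable_box)
  have "(LINT x|?M. box_bump a b n x *\<^sub>R h x) = 0" for n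
  proof -
    have "(LINT x|lebesgue_on U. box_bump a b n x *\<^sub>R h x) = 0"
      by (intro test box_bump_test_function assms)
    then show ?thesis
      using assms box_subset_cbox[of a b]
      by (subst (asm) integral_lebesgue_on_supp[of "cbox a b"]) (auto intro!: box_bump_outside)
  qed
  moreover have "(\<lambda>n. LINT x|?M. box_bump a b n x *\<^sub>R h x) \<longlonglongrightarrow> (LINT x|?M. indicator (box a b) x *\<^sub>R h x)"
  proof (rule integral_dominated_convergence)
    show "integrable ?M (\<lambda>x. norm (h x))" using h by simp
    show "AE x in ?M. (\<lambda>n. box_bump a b n x *\<^sub>R h x) \<longlonglongrightarrow> indicator (box a b) x *\<^sub>R h x"
      by (intro AE_I2 tendsto_intros box_bump_tendsto)
    show "AE x in ?M. norm (box_bump a b n x *\<^sub>R h x) \<le> norm (h x)" for n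
      using box_bump_range by (auto intro!: AE_I2 mult_left_le_one_le simp: abs_le_iff)
  qed auto
  ultimately have "(LINT x|?M. indicator (box a b) x *\<^sub>R h x) = 0"
    by (simp add: LIMSEQ_const_iff)
  moreover have "AE x in ?M. indicator (box a b) x *\<^sub>R h x = h x"
  proof -
    have "cbox a b - box a b \<in> null_sets lebesgue"
      using negligible_frontier_interval negligible_iff_null_sets by blast
    from AE_not_in[OF this] have "AE x in ?M. x \<notin> cbox a b - box a b"
      by (simp add: AE_restrict_space_iff)
    then show ?thesis by (rule AE_mp) (auto intro!: AE_I2)
  qed
  ultimately show ?thesis
    by (subst (asm) integral_cong_AE[where g = h]) auto
qed

text \<open>The fundamental lemma of the calculus of variations. The function has zero integral over every
  closed box inside \<open>U\<close>. Cut off outside one such box, it has zero integral over all boxes, since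
  the intersection of two boxes is a box; by Lebesgue differentiation it then vanishes almost
  everywhere. Countably many boxes cover \<open>U\<close>.\<close>

lemma locally_integrable_AE_eq_0:
  fixes h :: "plane \<Rightarrow> 'a::euclidean_space"
  assumes U: "open U" and h: "locally_integrable U h"
    and test: "\<And>\<phi>. \<phi> \<in> test_functions U \<Longrightarrow> (LINT x|lebesgue_on U. \<phi> x *\<^sub>R h x) = 0"
  shows "AE x in lebesgue_on U. h x = 0"
proof -
  have box: "\<exists>N. N \<in> null_sets lebesgue \<and> (\<forall>x\<in>cbox c d - N. h x = 0)" if cd: "cbox c d \<subseteq> U" for c d
  proof -
    define H where "H x = (if x \<in> cbox c d then h x else 0)" for x
    have "integrable (lebesgue_on (cbox c d)) h"
      using h cd by (auto simp: locally_integrable_def)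
    then have "h integrable_on cbox c d" by (rule integrable_on_lebesgue_on) auto
    then have H_int: "H integrable_on cbox a b" for a b
    proof -
      obtain a' b' where ab: "cbox c d \<inter> cbox a b = cbox a' b'" using Int_interval by blast
      have "cbox a' b' \<subseteq> cbox c d" unfolding ab[symmetric] by (rule Int_lower1)
      then have "h integrable_on cbox a' b'"
        by (rule integrable_on_subcbox[OF \<open>h integrable_on cbox c d\<close>])
      then show ?thesis unfolding H_def integrable_restrict_Int ab .
    qed
    have H_0: "integral (cbox a b) H = 0" for a b
    proof -
      obtain a' b' where ab: "cbox c d \<inter> cbox a b = cbox a' b'" using Int_interval by blast
      have "cbox a' b' \<subseteq> cbox c d" unfolding ab[symmetric] by (rule Int_lower1)
      then have sub: "cbox a' b' \<subseteq> U" using cd by (rule order_trans)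
      have "integral (cbox a b) H = integral (cbox a' b') h"
        unfolding H_def integral_restrict_Int ab ..
      also have "\<dots> = (LINT x|lebesgue_on (cbox a' b'). h x)"
        using h sub by (subst lebesgue_integral_eq_integral) (auto simp: locally_integrable_def)
      finally show ?thesis using integral_cbox_eq_0[OF U h sub test] by simp
    qed
    obtain N where N: "negligible N"
      "\<And>x e. \<lbrakk>x \<notin> N; 0 < e\<rbrakk> \<Longrightarrow> \<exists>d>0. \<forall>h. 0 < h \<and> h < d \<longrightarrow>
         norm (integral (cbox x (x + h *\<^sub>R One)) H /\<^sub>R h ^ DIM(plane) - H x) < e"
      using integrable_ccontinuous_explicit[of H, OF H_int] by blast
    have "H x = 0" if x: "x \<notin> N" for x
    proof (rule ccontr)
      assume "H x \<noteq> 0"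
      then have "\<exists>d>0::real. \<forall>h. 0 < h \<and> h < d \<longrightarrow> norm (H x) < norm (H x)"
        using N(2)[OF x, of "norm (H x)"] by (simp add: H_0)
      then show False using dense by blast
    qed
    then have "\<forall>x\<in>cbox c d - N. h x = 0" unfolding H_def by (metis DiffE)
    then show ?thesis
      using N(1) by (auto simp: negligible_iff_null_sets)
  qed
  obtain \<D> where \<D>: "countable \<D>" "\<And>X. X \<in> \<D> \<Longrightarrow> \<exists>a b. X = cbox a b" "\<Union>\<D> = U"
    using open_countable_Union_open_cbox[OF U] by metis
  have "\<forall>X\<in>\<D>. \<exists>N. N \<in> null_sets lebesgue \<and> (\<forall>x\<in>X - N. h x = 0)"
    using box \<D> by (metis Union_upper)
  then obtain N where N: "\<forall>X\<in>\<D>. N X \<in> null_sets lebesgue \<and> (\<forall>x\<in>X - N X. h x = 0)"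
    by metis
  then have "(\<Union>X\<in>\<D>. N X) \<in> null_sets lebesgue"
    using \<D>(1) by (intro null_sets_UN') auto
  from AE_not_in[OF this] have "AE x in lebesgue. x \<in> U \<longrightarrow> h x = 0"
    by (rule AE_mp) (use N \<D>(3) in \<open>auto intro!: AE_I2\<close>)
  then show ?thesis using U by (simp add: AE_restrict_space_iff)
qed

lemma locally_integrable_diff:
  "locally_integrable U f \<Longrightarrow> locally_integrable U g \<Longrightarrow> locally_integrable U (\<lambda>x. f x - g x)"
  by (auto simp: locally_integrable_def)

lemma has_weak_gradient_diff:
  assumes U: "open U" and u: "has_weak_gradient U u g" and v: "has_weak_gradient U v h"
  shows "has_weak_gradient U (\<lambda>x. u x - v x) (\<lambda>x. g x - h x)"
  unfolding has_weak_gradient_def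
proof (intro conjI ballI)
  show "locally_integrable U (\<lambda>x. u x - v x)" "locally_integrable U (\<lambda>x. g x - h x)"
    using u v by (auto simp: has_weak_gradient_def locally_integrable_diff)
  fix \<phi> assume \<phi>: "\<phi> \<in> test_functions U"
  obtain S where S: "compact S" "S \<subseteq> U" "\<And>x. x \<notin> S \<Longrightarrow> \<phi> x = 0" "\<And>x. x \<notin> S \<Longrightarrow> gradient \<phi> x = 0"
    using test_function_support[OF \<phi>] by blast
  have [simp]: "U \<in> sets lebesgue" using U by simp
  have "integrable (lebesgue_on U) (\<lambda>x. w x *\<^sub>R gradient \<phi> x)" if "locally_integrable U w" for w
    by (rule locally_integrable_bilinear_compact_support
        [OF bounded_bilinear.flip[OF bounded_bilinear_scaleR] that _ S(1,2,4) test_function_continuous(2)[OF \<phi>]]) auto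
  moreover have "integrable (lebesgue_on U) (\<lambda>x. \<phi> x *\<^sub>R w x)" if "locally_integrable U w" for w :: "plane \<Rightarrow> plane"
    by (rule locally_integrable_bilinear_compact_support
        [OF bounded_bilinear_scaleR that _ S(1,2,3) test_function_continuous(1)[OF \<phi>]]) auto
  ultimately show "(LINT x|lebesgue_on U. (u x - v x) *\<^sub>R gradient \<phi> x)
      = - (LINT x|lebesgue_on U. \<phi> x *\<^sub>R (g x - h x))"
    using u v \<phi> by (simp add: has_weak_gradient_def algebra_simps)
qed

text \<open>This is what gives \<open>weak_gradient\<close>, a choice among all representatives, its usual calculus
  almost everywhere.\<close>

lemma has_weak_gradient_AE_unique:
  assumes U: "open U" and g: "has_weak_gradient U u g" and h: "has_weak_gradient U u h"
  shows "AE x in lebesgue_on U. g x = h x"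
proof -
  have "has_weak_gradient U (\<lambda>x. 0) (\<lambda>x. g x - h x)"
    using has_weak_gradient_diff[OF assms] by simp
  then have "AE x in lebesgue_on U. g x - h x = 0"
    using U by (intro locally_integrable_AE_eq_0) (auto simp: has_weak_gradient_def)
  then show ?thesis by simp
qed

lemma has_weak_gradient_weak_gradient: "has_weak_gradient U u g \<Longrightarrow> has_weak_gradient U u (weak_gradient U u)"
  unfolding weak_gradient_def by (rule someI[of "has_weak_gradient U u"])

lemma weak_gradient_AE_eq:
  "open U \<Longrightarrow> has_weak_gradient U u g \<Longrightarrow> AE x in lebesgue_on U. weak_gradient U u x = g x"
  by (blast intro: has_weak_gradient_AE_unique has_weak_gradient_weak_gradient)

lemma has_weak_gradient_subset:
  assumes "open U" "open V" "V \<subseteq> U" and u: "has_weak_gradient U u g"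
  shows "has_weak_gradient V u g"
  unfolding has_weak_gradient_def
proof (intro conjI ballI)
  show "locally_integrable V u" "locally_integrable V g"
    using u \<open>V \<subseteq> U\<close> by (auto simp: has_weak_gradient_def locally_integrable_def)
  fix \<phi> assume \<phi>: "\<phi> \<in> test_functions V"
  obtain S where S: "compact S" "S \<subseteq> V" "\<And>x. x \<notin> S \<Longrightarrow> \<phi> x = 0" "\<And>x. x \<notin> S \<Longrightarrow> gradient \<phi> x = 0"
    using test_function_support[OF \<phi>] by blast
  have "\<phi> \<in> test_functions U" using \<phi> \<open>V \<subseteq> U\<close> by (auto simp: test_functions_def)
  then have "(LINT x|lebesgue_on U. u x *\<^sub>R gradient \<phi> x) = - (LINT x|lebesgue_on U. \<phi> x *\<^sub>R g x)"
    using u by (simp add: has_weak_gradient_def)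
  moreover have "(LINT x|lebesgue_on U. F x) = (LINT x|lebesgue_on V. F x)"
    if "\<And>x. x \<notin> S \<Longrightarrow> F x = 0" for F :: "plane \<Rightarrow> plane"
    using assms S(2) by (intro integral_lebesgue_on_supp) (auto intro!: that)
  ultimately show "(LINT x|lebesgue_on V. u x *\<^sub>R gradient \<phi> x) = - (LINT x|lebesgue_on V. \<phi> x *\<^sub>R g x)"
    using S by simp
qed

section \<open>Convolution with a differentiable kernel\<close>

text \<open>A differentiable kernel with bounded gradient is Lipschitz, so its difference quotients are
  uniformly bounded and differentiation passes under the integral sign by dominated convergence.
  The gradient of \<open>k \<star> w\<close> is thus \<open>k' \<star> w\<close>, it is continuous, and its norm is at most
  \<open>sup \<bar>k'\<bar> \<cdot> \<parallel>w\<parallel>\<^sub>1\<close>. Boundedness of \<open>k\<close> itself makes \<open>k \<star> w\<close> well defined.\<close>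

context
  fixes k :: "'a::euclidean_space \<Rightarrow> real" and k' :: "'a \<Rightarrow> 'a" and M B :: real
    and G :: "'a set" and w :: "'a \<Rightarrow> real"
  assumes k: "\<And>z. GDERIV k z :> k' z" "\<And>z. \<bar>k z\<bar> \<le> B"
    and k': "continuous_on UNIV k'" "\<And>z. norm (k' z) \<le> M"
    and w: "integrable (lebesgue_on G) w" and G: "G \<in> sets lebesgue"
begin

lemma kernel_translate_measurable:
  "(\<lambda>z. k (x - z)) \<in> borel_measurable (lebesgue_on G)"
  "(\<lambda>z. k' (x - z)) \<in> borel_measurable (lebesgue_on G)"
proof -
  have "continuous_on UNIV k"
    using k(1) by (auto simp: gderiv_def continuous_on_eq_continuous_at intro: has_derivative_continuous)
  then show "(\<lambda>z. k (x - z)) \<in> borel_measurable (lebesgue_on G)"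
    by (intro continuous_imp_measurable_on_sets_lebesgue G)
       (auto intro!: continuous_intros elim: continuous_on_compose2)
  show "(\<lambda>z. k' (x - z)) \<in> borel_measurable (lebesgue_on G)"
    using k'(1) by (intro continuous_imp_measurable_on_sets_lebesgue G)
       (auto intro!: continuous_intros elim: continuous_on_compose2)
qed

lemma kernel_gradient_integrable: "integrable (lebesgue_on G) (\<lambda>z. w z *\<^sub>R k' (x - z))"
proof (rule Bochner_Integration.integrable_bound)
  show "integrable (lebesgue_on G) (\<lambda>z. M * norm (w z))" using w by simp
  show "(\<lambda>z. w z *\<^sub>R k' (x - z)) \<in> borel_measurable (lebesgue_on G)"
    using w kernel_translate_measurable by auto
  have "norm (w z *\<^sub>R k' (x - z)) \<le> norm (M * norm (w z))" for z
    using mult_left_mono[OF k'(2)[of "x - z"], of "\<bar>w z\<bar>"] by (simp add: mult.commute)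
  then show "AE z in lebesgue_on G. norm (w z *\<^sub>R k' (x - z)) \<le> norm (M * norm (w z))"
    by simp
qed

lemma kernel_integrable: "integrable (lebesgue_on G) (\<lambda>z. k (x - z) * w z)"
proof (rule Bochner_Integration.integrable_bound)
  show "integrable (lebesgue_on G) (\<lambda>z. B * norm (w z))" using w by simp
  show "(\<lambda>z. k (x - z) * w z) \<in> borel_measurable (lebesgue_on G)"
    using w kernel_translate_measurable by auto
  have "norm (k (x - z) * w z) \<le> norm (B * norm (w z))" for z
    using mult_right_mono[OF k(2)[of "x - z"], of "\<bar>w z\<bar>"] abs_ge_self[of B]
    by (simp add: abs_mult) (meson abs_ge_zero mult_right_mono order_trans)
  then show "AE z in lebesgue_on G. norm (k (x - z) * w z) \<le> norm (B * norm (w z))"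
    by simp
qed

lemma norm_convolution_gradient_le:
  "norm (LINT z|lebesgue_on G. w z *\<^sub>R k' (x - z)) \<le> M * (LINT z|lebesgue_on G. \<bar>w z\<bar>)"
proof -
  have "norm (LINT z|lebesgue_on G. w z *\<^sub>R k' (x - z)) \<le> (LINT z|lebesgue_on G. M * \<bar>w z\<bar>)"
  proof (rule Bochner_Integration.integral_norm_bound_integral)
    show "norm (w z *\<^sub>R k' (x - z)) \<le> M * \<bar>w z\<bar>" for z
      using mult_left_mono[OF k'(2)[of "x - z"], of "\<bar>w z\<bar>"] by (simp add: mult.commute)
  qed (use w kernel_gradient_integrable in auto)
  then show ?thesis by simp
qed

lemma continuous_on_convolution_gradient:
  "continuous_on UNIV (\<lambda>x. LINT z|lebesgue_on G. w z *\<^sub>R k' (x - z))"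
proof (rule continuous_on_sequentiallyI)
  fix X :: "nat \<Rightarrow> 'a" and x assume X: "X \<longlonglongrightarrow> x"
  show "(\<lambda>n. LINT z|lebesgue_on G. w z *\<^sub>R k' (X n - z)) \<longlonglongrightarrow> (LINT z|lebesgue_on G. w z *\<^sub>R k' (x - z))"
  proof (rule integral_dominated_convergence)
    show "integrable (lebesgue_on G) (\<lambda>z. M * \<bar>w z\<bar>)" using w by simp
    have "(\<lambda>n. k' (X n - z)) \<longlonglongrightarrow> k' (x - z)" for z
      using k'(1) X
      by (intro continuous_on_tendsto_compose[of UNIV k'] tendsto_intros) auto
    then show "AE z in lebesgue_on G. (\<lambda>n. w z *\<^sub>R k' (X n - z)) \<longlonglongrightarrow> w z *\<^sub>R k' (x - z)"
      by (intro AE_I2 tendsto_intros)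
    have "norm (w z *\<^sub>R k' y) \<le> M * \<bar>w z\<bar>" for z y
      using mult_left_mono[OF k'(2)[of y], of "\<bar>w z\<bar>"] by (simp add: mult.commute)
    then show "AE z in lebesgue_on G. norm (w z *\<^sub>R k' (X n - z)) \<le> M * \<bar>w z\<bar>" for n
      by simp
  qed (use kernel_gradient_integrable in \<open>auto simp: integrable_iff_bounded\<close>)
qed

lemma GDERIV_convolution:
  "GDERIV (\<lambda>x. LINT z|lebesgue_on G. k (x - z) * w z) x :> (LINT z|lebesgue_on G. w z *\<^sub>R k' (x - z))"
proof -
  let ?L = "lebesgue_on G"
  \<comment> \<open>The remainder of the first-order expansion of \<open>k\<close>, divided by the norm of the increment; its
    integral is the same quotient for the convolution.\<close>
  define R where "R h z = (k (x + h - z) - k (x - z) - h \<bullet> k' (x - z)) * w z / norm h" for h z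
  have "onorm (\<lambda>h. h \<bullet> k' z) \<le> M" for z
  proof (rule onorm_bound)
    show "0 \<le> M" using k'(2)[of z] norm_ge_zero[of "k' z"] by linarith
    show "norm (h \<bullet> k' z) \<le> M * norm h" for h
      using Cauchy_Schwarz_ineq2[of h "k' z"] mult_left_mono[OF k'(2)[of z], of "norm h"]
      by (simp add: mult.commute)
  qed
  then have Lip: "\<bar>k a - k b\<bar> \<le> M * norm (a - b)" for a b
    using differentiable_bound[of UNIV k "\<lambda>z h. h \<bullet> k' z" M a b] k(1)
    by (simp add: gderiv_def)
  have R_le: "norm (R h z) \<le> 2 * M * \<bar>w z\<bar>" for h z
  proof (cases "h = 0")
    case False
    have "\<bar>h \<bullet> k' (x - z)\<bar> \<le> M * norm h"
      using Cauchy_Schwarz_ineq2[of h "k' (x - z)"] mult_left_mono[OF k'(2)[of "x - z"], of "norm h"]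
      by (simp add: mult.commute)
    then have "\<bar>k (x + h - z) - k (x - z) - h \<bullet> k' (x - z)\<bar> \<le> 2 * M * norm h"
      using Lip[of "x + h - z" "x - z"] by simp
    then have "\<bar>k (x + h - z) - k (x - z) - h \<bullet> k' (x - z)\<bar> * \<bar>w z\<bar> \<le> 2 * M * norm h * \<bar>w z\<bar>"
      by (rule mult_right_mono) auto
    with False show ?thesis by (simp add: R_def abs_mult divide_le_eq mult_ac)
  next
    case True
    have "0 \<le> M" using order_trans[OF norm_ge_zero k'(2)] .
    then show ?thesis using True by (simp add: R_def)
  qed
  have R_int: "(LINT z|?L. R h z) =
      ((LINT z|?L. k (x + h - z) * w z) - (LINT z|?L. k (x - z) * w z) - h \<bullet> (LINT z|?L. w z *\<^sub>R k' (x - z))) / norm h" for h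
  proof -
    have "R h z = (k (x + h - z) * w z - k (x - z) * w z - h \<bullet> (w z *\<^sub>R k' (x - z))) / norm h" for z
      by (simp add: R_def algebra_simps)
    then show ?thesis
      using kernel_integrable kernel_gradient_integrable[of x] by (simp del: inner_scaleR_right)
  qed
  have R_meas: "R h \<in> borel_measurable ?L" for h
    unfolding R_def using w kernel_translate_measurable by measurable
  have R_lim: "(\<lambda>n. R (X n) z) \<longlonglongrightarrow> 0" if X: "\<forall>n. X n \<noteq> 0" "X \<longlonglongrightarrow> 0" for X z
  proof -
    have "((\<lambda>h. (k (x - z + h) - k (x - z) - h \<bullet> k' (x - z)) / norm h) \<longlongrightarrow> 0) (at 0)"
      using k(1)[of "x - z"]
      by - (rule tendsto_norm_zero_cancel, simp add: gderiv_def has_derivative_at)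
    from this[unfolded tendsto_at_iff_sequentially, rule_format, of X] X
    have "(\<lambda>n. (k (x - z + X n) - k (x - z) - X n \<bullet> k' (x - z)) / norm (X n)) \<longlonglongrightarrow> 0"
      by (simp add: o_def)
    from tendsto_mult_right_zero[OF this, of "w z"] show ?thesis
      by (simp add: R_def algebra_simps)
  qed
  have "((\<lambda>h. LINT z|?L. R h z) \<longlongrightarrow> 0) (at 0)"
    unfolding tendsto_at_iff_sequentially
  proof (intro allI impI)
    fix X :: "nat \<Rightarrow> 'a" assume X: "\<forall>n. X n \<in> UNIV - {0}" "X \<longlonglongrightarrow> 0"
    have "(\<lambda>n. LINT z|?L. R (X n) z) \<longlonglongrightarrow> (LINT z|?L. 0)"
    proof (rule integral_dominated_convergence)
      show "integrable ?L (\<lambda>z. 2 * M * \<bar>w z\<bar>)" using w by simp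
      show "AE z in ?L. (\<lambda>n. R (X n) z) \<longlonglongrightarrow> 0" using X R_lim by auto
    qed (use R_le R_meas in auto)
    then show "((\<lambda>h. LINT z|?L. R h z) \<circ> X) \<longlonglongrightarrow> 0" by (simp add: o_def)
  qed
  from tendsto_norm_zero[OF this] show ?thesis
    by (simp add: gderiv_def has_derivative_at R_int bounded_linear_inner_left)
qed

end

lemma GDERIV_gauss_kernel:
  assumes "\<sigma> > 0"
  shows "GDERIV (gauss_kernel \<sigma>) z :> - (gauss_kernel \<sigma> z / \<sigma>\<^sup>2) *\<^sub>R z"
  using assms unfolding gderiv_def gauss_kernel_def power2_norm_eq_inner
  by (auto intro!: derivative_eq_intros simp: fun_eq_iff inner_commute field_simps)

text \<open>With \<open>s = \<bar>z\<bar> / \<sigma>\<close> the norm is \<open>s exp (- s\<^sup>2 / 2) / (2 \<pi> \<sigma>\<^sup>3)\<close>, and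
  \<open>s \<le> 1 + s\<^sup>2 / 2 \<le> exp (s\<^sup>2 / 2)\<close>.\<close>

lemma norm_gauss_kernel_gradient_le:
  assumes "\<sigma> > 0"
  shows "norm (- (gauss_kernel \<sigma> z / \<sigma>\<^sup>2) *\<^sub>R z) \<le> 1 / (2 * pi * \<sigma>^3)"
proof -
  define s where "s = norm z / \<sigma>"
  have s: "norm z = s * \<sigma>" "s \<ge> 0" using assms by (auto simp: s_def)
  have "2 * s \<le> 2 + s\<^sup>2" using zero_le_power2[of "s - 1"] by (simp add: power2_eq_square algebra_simps)
  then have "s \<le> 1 + s\<^sup>2 / 2" by simp
  also have "\<dots> \<le> exp (s\<^sup>2 / 2)" by (rule exp_ge_add_one_self)
  finally have "s * exp (- s\<^sup>2 / 2) \<le> 1" by (simp add: exp_minus field_simps)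
  moreover have "norm (- (gauss_kernel \<sigma> z / \<sigma>\<^sup>2) *\<^sub>R z) = s * exp (- s\<^sup>2 / 2) / (2 * pi * \<sigma>^3)"
    using assms by (simp add: gauss_kernel_def s abs_mult power_mult_distrib field_simps eval_nat_numeral)
  ultimately show ?thesis using assms by (simp add: divide_right_mono)
qed

lemma abs_gauss_kernel_le: "\<bar>gauss_kernel \<sigma> z\<bar> \<le> 1 / (2 * pi * \<sigma>\<^sup>2)"
  by (simp add: gauss_kernel_def abs_mult divide_right_mono)

lemma
  assumes \<sigma>: "\<sigma> > 0" and w: "integrable (lebesgue_on G) w" and G: "G \<in> sets lebesgue"
  shows continuous_on_gradient_smoothing: "continuous_on UNIV (gradient (smoothing \<sigma> G w))"
    and norm_gradient_smoothing_le:
      "norm (gradient (smoothing \<sigma> G w) x) \<le> 1 / (2 * pi * \<sigma>^3) * (LINT z|lebesgue_on G. \<bar>w z\<bar>)"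
proof -
  let ?k' = "\<lambda>z. - (gauss_kernel \<sigma> z / \<sigma>\<^sup>2) *\<^sub>R z"
  have cont: "continuous_on UNIV ?k'"
    unfolding gauss_kernel_def using \<sigma> by (auto intro!: continuous_intros)
  note conv = GDERIV_gauss_kernel[OF \<sigma>] abs_gauss_kernel_le cont norm_gauss_kernel_gradient_le[OF \<sigma>] w G
  have eq: "gradient (smoothing \<sigma> G w) = (\<lambda>x. LINT z|lebesgue_on G. w z *\<^sub>R ?k' (x - z))"
    unfolding smoothing_def[abs_def] using GDERIV_convolution[OF conv] gradient_eq by blast
  show "continuous_on UNIV (gradient (smoothing \<sigma> G w))"
    unfolding eq by (rule continuous_on_convolution_gradient[OF conv])
  show "norm (gradient (smoothing \<sigma> G w) x) \<le> 1 / (2 * pi * \<sigma>^3) * (LINT z|lebesgue_on G. \<bar>w z\<bar>)"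
    unfolding eq by (rule norm_convolution_gradient_le[OF conv])
qed

section \<open>Lebesgue and Sobolev norms\<close>

lemma Lp_1_iff: "Lp 1 U u \<longleftrightarrow> integrable (lebesgue_on U) u"
  by (auto simp: Lp_def integrable_norm_iff)

lemma Lp_norm_1: "Lp_norm 1 U u = (LINT x|lebesgue_on U. norm (u x))"
  by (simp add: Lp_norm_def)

lemma Lp_2_iff:
  "Lp 2 U u \<longleftrightarrow> u \<in> borel_measurable (lebesgue_on U) \<and> integrable (lebesgue_on U) (\<lambda>x. (norm (u x))\<^sup>2)"
  by (simp add: Lp_def)

lemma Lp_subset:
  assumes "Lp p U u" "V \<subseteq> U" "U \<in> sets lebesgue" "V \<in> sets lebesgue"
  shows "Lp p V u"
proof -
  have "set_integrable lebesgue U (\<lambda>x. norm (u x) powr p)"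
    using assms by (simp add: Lp_def set_integrable_def integrable_restrict_space)
  from set_integrable_subset[OF this, of V] show ?thesis
    using assms by (auto simp: Lp_def set_integrable_def integrable_restrict_space
        intro: measurable_restrict_mono)
qed

lemma borel_measurable_lebesgue_on_AE:
  fixes u :: "plane \<Rightarrow> 'a::euclidean_space"
  assumes U: "U \<in> sets lebesgue" and u: "u \<in> borel_measurable (lebesgue_on U)"
    and ae: "AE x in lebesgue_on U. u x = v x"
  shows "v \<in> borel_measurable (lebesgue_on U)"
proof -
  have "(\<lambda>x. indicator U x *\<^sub>R v x) \<in> borel_measurable lebesgue"
  proof (rule borel_measurable_AE)
    show "(\<lambda>x. indicator U x *\<^sub>R u x) \<in> borel_measurable lebesgue"
      using u U by (simp add: borel_measurable_restrict_space_iff)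
    have "AE x in lebesgue. x \<in> U \<longrightarrow> u x = v x"
      using ae U by (simp add: AE_restrict_space_iff)
    then show "AE x in lebesgue. indicator U x *\<^sub>R u x = indicator U x *\<^sub>R v x"
      by eventually_elim (auto simp: indicator_def)
  qed
  then show ?thesis using U by (simp add: borel_measurable_restrict_space_iff)
qed

lemma Lp_AE_cong:
  fixes u :: "plane \<Rightarrow> 'a::euclidean_space"
  assumes U: "U \<in> sets lebesgue" and u: "Lp p U u" and ae: "AE x in lebesgue_on U. u x = v x"
  shows "Lp p U v"
proof -
  have v: "v \<in> borel_measurable (lebesgue_on U)"
    using borel_measurable_lebesgue_on_AE[OF U _ ae] u by (auto simp: Lp_def)
  have "integrable (lebesgue_on U) (\<lambda>x. norm (v x) powr p)"
    by (rule integrable_cong_AE_imp[of _ "\<lambda>x. norm (u x) powr p"])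
       (use u v ae in \<open>auto simp: Lp_def\<close>)
  with v show ?thesis by (simp add: Lp_def)
qed

text \<open>The Cauchy-Schwarz inequality against the constant function \<open>1\<close>, from integrating
  \<open>(\<bar>u\<bar> - t)\<^sup>2 \<ge> 0\<close> and choosing the best \<open>t\<close>, the mean of \<open>\<bar>u\<bar>\<close>.\<close>

lemma power2_norm_1_le:
  assumes U: "U \<in> lmeasurable" and u: "Lp 2 U u"
  shows "Lp 1 U u"
    and "(Lp_norm 1 U u)\<^sup>2 \<le> measure lebesgue U * (LINT x|lebesgue_on U. (norm (u x))\<^sup>2)"
proof -
  let ?L = "lebesgue_on U"
  define I where "I = (LINT x|lebesgue_on U. (norm (u x))\<^sup>2)"
  let ?a = "Lp_norm 1 U u" and ?m = "measure lebesgue U"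
  interpret finite_measure ?L using U by (rule finite_measure_lebesgue_on)
  have meas: "u \<in> borel_measurable ?L" and sq: "integrable ?L (\<lambda>x. (norm (u x))\<^sup>2)"
    using u by (auto simp: Lp_2_iff)
  have m: "measure ?L U = ?m"
    using U by (simp add: measure_restrict_space fmeasurableD)
  have le_square: "norm r \<le> norm (1 + (norm r)\<^sup>2)" for r :: 'a
    using zero_le_power2[of "norm r - 1 / 2"] by (simp add: power2_eq_square algebra_simps)
  have "integrable ?L u"
    by (rule Bochner_Integration.integrable_bound[of _ "\<lambda>x. 1 + (norm (u x))\<^sup>2"])
       (use sq meas le_square in auto)
  then show "Lp 1 U u" by (simp add: Lp_1_iff)
  have quad: "2 * t * ?a \<le> I + t\<^sup>2 * ?m" for t
  proof -
    have "2 * t * ?a = (LINT x|?L. 2 * t * norm (u x))"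
      by (simp add: Lp_norm_1)
    also have "\<dots> \<le> (LINT x|?L. (norm (u x))\<^sup>2 + t\<^sup>2)"
    proof (rule integral_mono)
      show "2 * t * norm (u x) \<le> (norm (u x))\<^sup>2 + t\<^sup>2" for x
        using zero_le_power2[of "norm (u x) - t"] by (simp add: power2_eq_square algebra_simps)
    qed (use sq \<open>integrable ?L u\<close> in auto)
    also have "\<dots> = I + t\<^sup>2 * ?m" using sq by (simp add: m I_def)
    finally show ?thesis .
  qed
  have "?a\<^sup>2 \<le> ?m * I"
  proof (cases "?m = 0")
    case True
    \<comment> \<open>On a null set there is no mean, but then \<open>2 t \<parallel>u\<parallel>\<^sub>1\<close> is bounded uniformly in \<open>t\<close>.\<close>
    have "?a \<ge> 0" by (simp add: Lp_norm_1)
    moreover have "?a \<le> 0"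
    proof (rule ccontr)
      assume "\<not> ?a \<le> 0"
      then have "?a > 0" by simp
      then have "2 * (I + 1) \<le> I" using quad[of "(I + 1) / ?a"] True by simp
      moreover have "I \<ge> 0" by (simp add: I_def)
      ultimately show False by auto
    qed
    ultimately show ?thesis using True by simp
  next
    case False
    then have m: "?m > 0" using zero_less_measure_iff by blast
    have "2 * (?a / ?m) * ?a * ?m \<le> (I + (?a / ?m)\<^sup>2 * ?m) * ?m"
      using quad[of "?a / ?m"] m by (intro mult_right_mono) auto
    with m show ?thesis by (simp add: power2_eq_square algebra_simps)
  qed
  then show "?a\<^sup>2 \<le> ?m * (LINT x|?L. (norm (u x))\<^sup>2)"
    by (simp add: I_def)
qed

text \<open>Membership in \<open>W1 p U\<close> only speaks of some \<open>p\<close>-integrable weak gradient; uniqueness transfers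
  this, including measurability, to the chosen representative.\<close>

lemma weak_gradient_W1:
  assumes U: "open U" and u: "u \<in> W1 p U"
  shows "has_weak_gradient U u (weak_gradient U u)" "Lp p U (weak_gradient U u)"
proof -
  obtain g where g: "has_weak_gradient U u g" "Lp p U g" using u by (auto simp: W1_def)
  then show "has_weak_gradient U u (weak_gradient U u)" by (blast intro: has_weak_gradient_weak_gradient)
  have "AE x in lebesgue_on U. g x = weak_gradient U u x"
    using weak_gradient_AE_eq[OF U g(1)] by (simp add: eq_commute)
  then show "Lp p U (weak_gradient U u)"
    using U g(2) by (intro Lp_AE_cong[OF _ g(2)]) auto
qed

lemma W1_2_imp_W1_1:
  assumes "U \<in> lmeasurable" "u \<in> W1 2 U"
  shows "u \<in> W1 1 U"
proof -
  obtain g where "Lp 2 U u" "has_weak_gradient U u g" "Lp 2 U g"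
    using assms(2) by (auto simp: W1_def)
  with power2_norm_1_le(1)[OF assms(1)] show ?thesis
    unfolding W1_def mem_Collect_eq by metis
qed

lemma W1_subset:
  assumes "u \<in> W1 p U" and UV: "open U" "open V" "V \<subseteq> U"
  shows "u \<in> W1 p V"
proof -
  have sets: "U \<in> sets lebesgue" "V \<in> sets lebesgue" using UV by auto
  obtain g where g: "Lp p U u" "has_weak_gradient U u g" "Lp p U g"
    using assms(1) by (auto simp: W1_def)
  have "Lp p V u" "Lp p V g"
    using Lp_subset[OF _ UV(3) sets] g by blast+
  moreover have "has_weak_gradient V u g"
    by (rule has_weak_gradient_subset[OF UV g(2)])
  ultimately show ?thesis by (auto simp: W1_def)
qed

lemma Lp_norm_1_weak_gradient_diff_le:
  assumes U: "open U" and u: "u \<in> W1 1 U" and v: "v \<in> W1 1 U"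
  shows "Lp_norm 1 U (weak_gradient U (\<lambda>x. u x - v x))
    \<le> Lp_norm 1 U (weak_gradient U u) + Lp_norm 1 U (weak_gradient U v)"
proof -
  let ?L = "lebesgue_on U" and ?grad = "weak_gradient U"
  note wu = weak_gradient_W1[OF U u, unfolded Lp_1_iff] and wv = weak_gradient_W1[OF U v, unfolded Lp_1_iff]
  have diff: "AE x in ?L. ?grad (\<lambda>x. u x - v x) x = ?grad u x - ?grad v x"
    by (rule weak_gradient_AE_eq[OF U has_weak_gradient_diff[OF U wu(1) wv(1)]])
  have "?grad (\<lambda>x. u x - v x) \<in> borel_measurable ?L"
    by (rule borel_measurable_lebesgue_on_AE[of _ "\<lambda>x. ?grad u x - ?grad v x"])
       (use U wu wv diff in \<open>auto simp: eq_commute\<close>)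
  then have "Lp_norm 1 U (?grad (\<lambda>x. u x - v x)) = (LINT x|?L. norm (?grad u x - ?grad v x))"
    unfolding Lp_norm_1 using wu wv diff by (intro integral_cong_AE) auto
  also have "\<dots> \<le> (LINT x|?L. norm (?grad u x) + norm (?grad v x))"
    using wu wv by (intro integral_mono) (auto simp: norm_triangle_ineq4)
  finally show ?thesis using wu wv by (simp add: Lp_norm_1)
qed

text \<open>Makes \<open>f\<close> itself a competitor in the minimisation problem. The zero functions approximate
  \<open>f - f\<close>; their norm is \<open>0\<close> because the weak gradient of \<open>0\<close>, being a choice, vanishes almost
  everywhere.\<close>

lemma trace_eq_refl:
  assumes G: "open G"
  shows "trace_eq G \<Gamma> f f"
proof -
  have 0: "has_weak_gradient G (\<lambda>x. 0) (\<lambda>x. 0)"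
    by (simp add: has_weak_gradient_def locally_integrable_def)
  then have W: "(\<lambda>x. 0) \<in> W1 1 G"
    by (auto simp: W1_def Lp_1_iff)
  have "AE x in lebesgue_on G. weak_gradient G (\<lambda>x. 0) x = 0"
    using weak_gradient_AE_eq[OF G 0] .
  then have "(LINT x|lebesgue_on G. norm (weak_gradient G (\<lambda>x. 0) x)) = 0"
    by (intro integral_eq_zero_AE) auto
  then have "W11_norm G (\<lambda>x. 0) = 0"
    by (simp add: W11_norm_def Lp_norm_1)
  with W show ?thesis
    unfolding trace_eq_def has_trace_def by (auto intro!: exI[of _ "\<lambda>n x. 0"])
qed

section \<open>The energy estimate\<close>

text \<open>A square dominates an affine function in the long run, whatever the size of \<open>B\<close>: if \<open>a j \<le> R\<close>
  and \<open>R \<ge> max 1 (A + B)\<close>, then \<open>A + B a j \<le> (A + B) R \<le> R\<^sup>2\<close>, and \<open>R\<close> bounds \<open>a (Suc j)\<close> as well.\<close>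

lemma bounded_of_sublinear_recursion:
  fixes a :: "nat \<Rightarrow> real"
  assumes "A \<ge> 0" "B \<ge> 0" "\<And>j. (a (Suc j))\<^sup>2 \<le> A + B * a j"
  shows "\<exists>R. \<forall>j. a j \<le> R"
proof -
  define R where "R = max (a 0) (1 + A + B)"
  have R: "R \<ge> 1" "A + B \<le> R" using assms by (auto simp: R_def)
  have "a j \<le> R" for j
  proof (induction j)
    case (Suc j)
    have "(a (Suc j))\<^sup>2 \<le> A + B * a j" by fact
    also have "\<dots> \<le> A * R + B * R"
      using R assms Suc by (intro add_mono mult_left_mono) (auto simp: mult_left_mono[of 1 R A, simplified])
    also have "\<dots> = (A + B) * R" by (simp add: algebra_simps)
    also have "\<dots> \<le> R\<^sup>2" using R by (simp add: power2_eq_square mult_right_mono)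
    finally show ?case using R by (simp add: power2_le_iff_abs_le)
  qed (simp add: R_def)
  then show ?thesis by blast
qed

lemma powr_minus_half_ge:
  assumes "0 \<le> (s::real)" "s \<le> P"
  shows "inverse (1 + P) \<le> (1 + s\<^sup>2) powr (- 1 / 2)"
proof -
  have "inverse (1 + P) = ((1 + P)\<^sup>2) powr (- 1 / 2)"
    using assms by (simp add: powr_minus powr_half_sqrt)
  also have "\<dots> \<le> (1 + s\<^sup>2) powr (- 1 / 2)"
  proof (rule powr_mono2')
    have "s\<^sup>2 \<le> P\<^sup>2" using assms by (intro power_mono) auto
    then show "1 + s\<^sup>2 \<le> (1 + P)\<^sup>2" using assms by (simp add: power2_eq_square algebra_simps)
    show "1 + s\<^sup>2 > 0" using zero_le_power2[of s] by linarith
  qed simp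
  finally show ?thesis .
qed

text \<open>The two sides of the ellipticity condition in integrated form. A bound on the argument \<open>p\<close> turns
  the degenerate lower bound into a uniform one. The energy density has to be shown measurable and
  integrable first, as the Bochner integral of a function that is not integrable is \<open>0\<close>.\<close>

lemma
  fixes D :: "plane \<Rightarrow> real^2^2"
  assumes D: "continuous_on UNIV D"
    and c: "c1 > 0" "c2 > 0"
    and lower: "\<And>p q. c1 * (1 + (norm p)\<^sup>2) powr (- 1 / 2) * (norm q)\<^sup>2 \<le> (D p *v q) \<bullet> q"
    and upper: "\<And>p q. (D p *v q) \<bullet> q \<le> c2 * (norm q)\<^sup>2"
    and G: "G \<in> sets lebesgue" and p: "continuous_on UNIV p" and g: "Lp 2 G g"
  shows energy_upper: "(LINT x|lebesgue_on G. (D (p x) *v g x) \<bullet> g x) \<le> c2 * (LINT x|lebesgue_on G. (norm (g x))\<^sup>2)"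
    and energy_lower: "\<And>P. (\<And>x. norm (p x) \<le> P) \<Longrightarrow>
      c1 * inverse (1 + P) * (LINT x|lebesgue_on G. (norm (g x))\<^sup>2) \<le> (LINT x|lebesgue_on G. (D (p x) *v g x) \<bullet> g x)"
proof -
  let ?L = "lebesgue_on G"
  have g': "g \<in> borel_measurable ?L" "integrable ?L (\<lambda>x. (norm (g x))\<^sup>2)"
    using g by (auto simp: Lp_2_iff)
  have "continuous_on UNIV (\<lambda>x. D (p x))"
    using D p by (rule continuous_on_compose2) auto
  then have Dp: "(\<lambda>x. D (p x)) \<in> borel_measurable ?L"
    using G by (intro continuous_imp_measurable_on_sets_lebesgue) (auto intro: continuous_on_subset)
  have "continuous_on UNIV (\<lambda>z :: (real^2^2) \<times> plane. (fst z *v snd z) \<bullet> snd z)"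
    unfolding inner_vec_def matrix_vector_mult_def by (auto intro!: continuous_intros)
  from borel_measurable_continuous_Pair[OF Dp g'(1), of "\<lambda>A q. (A *v q) \<bullet> q"] this
  have meas: "(\<lambda>x. (D (p x) *v g x) \<bullet> g x) \<in> borel_measurable ?L"
    by simp
  have nonneg: "0 \<le> (D r *v q) \<bullet> q" for r q
    using lower[of r q] c by (meson less_imp_le mult_nonneg_nonneg order_trans powr_ge_zero zero_le_power2)
  have int: "integrable ?L (\<lambda>x. (D (p x) *v g x) \<bullet> g x)"
  proof (rule Bochner_Integration.integrable_bound[OF _ meas])
    show "integrable ?L (\<lambda>x. c2 * (norm (g x))\<^sup>2)" using g' by simp
    show "AE x in ?L. norm ((D (p x) *v g x) \<bullet> g x) \<le> norm (c2 * (norm (g x))\<^sup>2)"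
      using upper nonneg c by (simp add: abs_of_nonneg)
  qed
  have "(LINT x|?L. (D (p x) *v g x) \<bullet> g x) \<le> (LINT x|?L. c2 * (norm (g x))\<^sup>2)"
    using int g' upper by (intro integral_mono) auto
  then show "(LINT x|?L. (D (p x) *v g x) \<bullet> g x) \<le> c2 * (LINT x|?L. (norm (g x))\<^sup>2)"
    by simp
  fix P assume P: "\<And>x. norm (p x) \<le> P"
  have "(LINT x|?L. c1 * inverse (1 + P) * (norm (g x))\<^sup>2) \<le> (LINT x|?L. (D (p x) *v g x) \<bullet> g x)"
  proof (rule integral_mono)
    show "c1 * inverse (1 + P) * (norm (g x))\<^sup>2 \<le> (D (p x) *v g x) \<bullet> g x" for x
      using powr_minus_half_ge[OF norm_ge_zero P[of x]] c
      by (intro order_trans[OF _ lower] mult_right_mono mult_left_mono) auto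
  qed (use int g' in auto)
  then show "c1 * inverse (1 + P) * (LINT x|?L. (norm (g x))\<^sup>2) \<le> (LINT x|?L. (D (p x) *v g x) \<bullet> g x)"
    by simp
qed

text \<open>Compare the energies of the minimiser \<open>v\<close> and of the competitor \<open>f\<close>. The ellipticity constant in
  \<open>J\<close> is at least \<open>c1 / (1 + P)\<close>, where the bound \<open>P\<close> of the smoothed gradient is linear in \<open>\<parallel>w\<parallel>\<^sub>1\<close>;
  so the square of \<open>\<parallel>\<nabla>v\<parallel>\<^sub>1\<close> is controlled by the first power of \<open>\<parallel>w\<parallel>\<^sub>1\<close>.\<close>

lemma is_T_gradient_bound:
  fixes D :: "plane \<Rightarrow> real^2^2"
  assumes \<sigma>: "\<sigma> > 0" and G: "open G" "G \<in> lmeasurable" and f: "f \<in> W1 2 G"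
    and D: "continuous_on UNIV D"
    and c: "c1 > 0" "c2 > 0"
    and lower: "\<And>p q. c1 * (1 + (norm p)\<^sup>2) powr (- 1 / 2) * (norm q)\<^sup>2 \<le> (D p *v q) \<bullet> q"
    and upper: "\<And>p q. (D p *v q) \<bullet> q \<le> c2 * (norm q)\<^sup>2"
    and T: "is_T \<sigma> G K f D w v"
  shows "(Lp_norm 1 G (weak_gradient G v))\<^sup>2 \<le>
    measure lebesgue G * (c2 / c1) * (LINT x|lebesgue_on G. (norm (weak_gradient G f x))\<^sup>2) *
      (1 + 1 / (2 * pi * \<sigma>^3) * Lp_norm 1 G w)"
proof -
  have Gs: "G \<in> sets lebesgue" using G(2) by (rule fmeasurableD)
  define P where "P = 1 / (2 * pi * \<sigma>^3) * Lp_norm 1 G w"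
  define E where "E u = (LINT x|lebesgue_on G. (norm (weak_gradient G u x))\<^sup>2)" for u
  have w: "integrable (lebesgue_on G) w" and v: "v \<in> W1 2 G"
    and min: "\<And>v'. v' \<in> admissible G K f \<Longrightarrow> J_functional \<sigma> G D w v \<le> J_functional \<sigma> G D w v'"
    using T by (auto simp: is_T_def W1_def admissible_def Lp_1_iff)
  have "P \<ge> 0" using \<sigma> by (simp add: P_def Lp_norm_1)
  have P: "norm (gradient (smoothing \<sigma> G w) x) \<le> P" for x
    using norm_gradient_smoothing_le[OF \<sigma> w Gs] by (simp add: P_def Lp_norm_1)
  note energy = D c lower upper Gs continuous_on_gradient_smoothing[OF \<sigma> w Gs]
  have "c1 * inverse (1 + P) * E v \<le> J_functional \<sigma> G D w v"
    unfolding J_functional_def E_def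
    by (rule energy_lower[OF energy weak_gradient_W1(2)[OF G(1) v] P])
  also have "\<dots> \<le> J_functional \<sigma> G D w f"
    using f trace_eq_refl[OF G(1)] by (intro min) (simp add: admissible_def)
  also have "\<dots> \<le> c2 * E f"
    unfolding J_functional_def E_def
    by (rule energy_upper[OF energy weak_gradient_W1(2)[OF G(1) f]])
  finally have "E v \<le> c2 / c1 * E f * (1 + P)"
    using c \<open>P \<ge> 0\<close> by (simp add: field_simps)
  then have "measure lebesgue G * E v \<le> measure lebesgue G * (c2 / c1 * E f * (1 + P))"
    by (rule mult_left_mono) simp
  moreover have "(Lp_norm 1 G (weak_gradient G v))\<^sup>2 \<le> measure lebesgue G * E v"
    unfolding E_def by (rule power2_norm_1_le(2)[OF G(2) weak_gradient_W1(2)[OF G(1) v]])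
  ultimately show ?thesis by (simp add: P_def E_def mult.assoc)
qed

theorem proposition4p1:
  fixes \<Omega> K G :: "(real^2) set" and C :: "nat \<Rightarrow> (real^2) set" and N :: nat
    and f :: "real^2 \<Rightarrow> real" and D :: "real^2 \<Rightarrow> real^2^2"
    and c1 c2 cP :: real
  assumes \<Omega>: "bounded \<Omega>" "lipschitz_domain \<Omega>"
    and N: "N \<ge> 1"
    and C: "\<And>i. i \<in> {1..N} \<Longrightarrow> lipschitz_domain (C i) \<and> C i \<subseteq> \<Omega> \<and> C i \<noteq> \<Omega>"
    and C_disjoint: "disjoint_family_on C {1..N}"
    and C_dist: "\<And>i j. i \<in> {1..N} \<Longrightarrow> j \<in> {1..N} \<Longrightarrow> i \<noteq> j \<Longrightarrow> setdist (C i) (C j) > 0"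
    and K_def: "K = closure (\<Union>i\<in>{1..N}. C i)"
    and G_def: "G = \<Omega> - K"
    and K: "compact K" "K \<subseteq> \<Omega>"
    and f: "\<And>x. x \<in> (\<Union>i\<in>{1..N}. C i) \<Longrightarrow> f x \<in> {0..1}"
      "f \<in> W1 2 (\<Union>i\<in>{1..N}. C i)" "f \<in> W1 2 \<Omega>"
    and D: "continuous_on UNIV D" "\<And>p. transpose (D p) = D p"
    and c: "c1 > 0" "c2 > 0"
    and D_lower: "\<And>p q. c1 * (1 + (norm p)\<^sup>2) powr (- 1 / 2) * (norm q)\<^sup>2 \<le> (D p *v q) \<bullet> q"
    and D_upper: "\<And>p q. (D p *v q) \<bullet> q \<le> c2 * (norm q)\<^sup>2"
    and cP: "cP > 0"
      "\<And>w. w \<in> W1 1 G \<Longrightarrow> trace_eq G (frontier K) w f \<Longrightarrow>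
         Lp_norm 1 G w \<le>
           cP * (Lp_norm 1 G (weak_gradient G (\<lambda>x. w x - f x)) + Lp_norm 1 G f)"
  shows "(\<exists>\<rho>>0. \<forall>\<sigma>>0. \<forall>u. T_iteration \<sigma> G K f D u \<longrightarrow> \<sigma>^4 > \<rho> \<longrightarrow>
            (SUP j. ereal (W11_norm G (u j))) < \<infinity>) \<and>
         (\<forall>\<sigma>>0. \<forall>u. T_iteration \<sigma> G K f D u \<longrightarrow>
            \<sigma>^4 > max (rho1 \<sigma> G f c1 c2 cP) (rho2 G f c1 c2 cP) \<longrightarrow>
            (SUP j. ereal (W11_norm G (u j))) < \<infinity>)"
proof -
  have "open \<Omega>" using \<Omega>(2) by (simp add: lipschitz_domain_def)
  then have G: "open G" "G \<subseteq> \<Omega>"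
    using K(1) by (auto simp: G_def compact_imp_closed)
  have Gm: "G \<in> lmeasurable"
    using \<Omega>(1) G by (intro lmeasurable_open) (auto intro: bounded_subset)
  have f2: "f \<in> W1 2 G" by (rule W1_subset[OF f(3) \<open>open \<Omega>\<close> G])
  have f1: "f \<in> W1 1 G" by (rule W1_2_imp_W1_1[OF Gm f2])
  have bounded: "(SUP j. ereal (W11_norm G (u j))) < \<infinity>"
    if \<sigma>: "\<sigma> > 0" and u: "T_iteration \<sigma> G K f D u" for \<sigma> u
  proof -
    define a where "a j = Lp_norm 1 G (weak_gradient G (u j))" for j
    define F where "F = Lp_norm 1 G (weak_gradient G f) + Lp_norm 1 G f"
    define S where "S = measure lebesgue G * (c2 / c1) * (LINT x|lebesgue_on G. (norm (weak_gradient G f x))\<^sup>2)"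
    define M where "M = 1 / (2 * pi * \<sigma>^3)"
    have T: "is_T \<sigma> G K f D (u j) (u (Suc j))" for j
      using u by (simp add: T_iteration_def)
    have u1: "u j \<in> W1 1 G" for j using T[of j] by (simp add: is_T_def)
    have trace: "trace_eq G (frontier K) (u j) f" for j
    proof (cases j)
      case 0
      then show ?thesis using u by (simp add: T_iteration_def)
    next
      case (Suc i)
      then show ?thesis using T[of i] by (simp add: is_T_def admissible_def)
    qed
    have nonneg: "F \<ge> 0" "S \<ge> 0" "M \<ge> 0"
      using c \<sigma> by (auto simp: F_def S_def M_def Lp_norm_1)
    have poincare: "Lp_norm 1 G (u j) \<le> cP * (a j + F)" for j
    proof -
      have "Lp_norm 1 G (u j) \<le>
          cP * (Lp_norm 1 G (weak_gradient G (\<lambda>x. u j x - f x)) + Lp_norm 1 G f)"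
        by (rule cP(2)[OF u1 trace])
      also have "\<dots> \<le> cP * (a j + F)"
        using Lp_norm_1_weak_gradient_diff_le[OF G(1) u1[of j] f1] cP(1)
        by (intro mult_left_mono) (auto simp: a_def F_def)
      finally show ?thesis .
    qed
    have "(a (Suc j))\<^sup>2 \<le> S * (1 + M * (cP * F)) + S * M * cP * a j" for j
    proof -
      have "(a (Suc j))\<^sup>2 \<le> S * (1 + M * Lp_norm 1 G (u j))"
        unfolding a_def S_def M_def
        by (rule is_T_gradient_bound[OF \<sigma> G(1) Gm f2 D(1) c D_lower D_upper T])
      also have "\<dots> \<le> S * (1 + M * (cP * (a j + F)))"
        using nonneg poincare by (intro mult_left_mono add_left_mono) auto
      finally show ?thesis by (simp add: algebra_simps)
    qed
    then obtain R where R: "\<And>j. a j \<le> R"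
      using bounded_of_sublinear_recursion[of "S * (1 + M * (cP * F))" "S * M * cP" a]
        nonneg cP(1) by auto
    have "W11_norm G (u j) \<le> cP * (R + F) + R" for j
    proof -
      have "W11_norm G (u j) \<le> cP * (a j + F) + a j"
        using poincare[of j] by (simp add: W11_norm_def a_def)
      also have "\<dots> \<le> cP * (R + F) + R"
        using R[of j] cP(1) by (intro add_mono mult_left_mono) auto
      finally show ?thesis .
    qed
    then have "(SUP j. ereal (W11_norm G (u j))) \<le> ereal (cP * (R + F) + R)"
      by (intro SUP_least) simp
    then show ?thesis by (rule le_less_trans) simp
  qed
  show ?thesis
  proof
    show "\<exists>\<rho>>0. \<forall>\<sigma>>0. \<forall>u. T_iteration \<sigma> G K f D u \<longrightarrow> \<sigma>^4 > \<rho> \<longrightarrow>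
        (SUP j. ereal (W11_norm G (u j))) < \<infinity>"
      using bounded by (intro exI[of _ 1]) simp
    show "\<forall>\<sigma>>0. \<forall>u. T_iteration \<sigma> G K f D u \<longrightarrow>
        \<sigma>^4 > max (rho1 \<sigma> G f c1 c2 cP) (rho2 G f c1 c2 cP) \<longrightarrow>
        (SUP j. ereal (W11_norm G (u j))) < \<infinity>"
      using bounded by blast
  qed
qed

end
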